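(* Let $G$ be a dense-subgroup-separable MAP abelian Hausdorff topological group whose connected component (of the neutral element) is nontrivial. Then $G$ is $d$-independent.
   Context: $\mathfrak{c}=|\mathbb{R}|$; $e$ is the neutral element. A topological group is dense-subgroup-separable if each of its dense subgroups is separable. A topological group $G$ is MAP if the family of its continuous homomorphisms to (finite-dimensional) unitary groups separates the points of $G$; for abelian $G$ this means that continuous homomorphisms to the unit circle group separate points. A nontrivial topological group $G$ is $d$-independent if for every subgroup $S$ of $G$ with $|S|<\mathfrak{c}$ there is a countable dense subgroup $H$ of $G$ with $S\cap H=\{e\}$. *)

theory Defs
  imports "HOL-Analysis.Analysis" "Jordan_Normal_Form.Schur_Decomposition"
begin

text \<open>
  A topological group is a type of class \<open>topological_group_add\<close>, written additively
  (the class does not include commutativity or the Hausdorff axiom). Properties of the group as a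
  whole take the type as argument, as in \<open>MAP TYPE('a)\<close>.
\<close>

definition add_subgroup :: "'a::group_add set \<Rightarrow> bool"
  where "add_subgroup H \<longleftrightarrow>
    0 \<in> H \<and> (\<forall>x\<in>H. \<forall>y\<in>H. x + y \<in> H) \<and> (\<forall>x\<in>H. - x \<in> H)"

definition dense_subgroup_separable :: "'a::topological_group_add itself \<Rightarrow> bool"
  where "dense_subgroup_separable _ \<longleftrightarrow>
    (\<forall>H::'a set. add_subgroup H \<and> closure H = UNIV \<longrightarrow> separable_space (top_of_set H))"

definition unitary_group :: "nat \<Rightarrow> complex mat set"
  where "unitary_group n =
    {U \<in> carrier_mat n n. U * mat_adjoint U = 1\<^sub>m n \<and> mat_adjoint U * U = 1\<^sub>m n}"

text \<open>
  The type of matrices carries no topology, so continuity of a map into the unitary group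
  (with its topology inherited from the space of complex \<open>n \<times> n\<close> matrices) is expressed entrywise.
\<close>

definition unitary_rep :: "nat \<Rightarrow> ('a::topological_group_add \<Rightarrow> complex mat) \<Rightarrow> bool"
  where "unitary_rep n \<pi> \<longleftrightarrow>
    (\<forall>x. \<pi> x \<in> unitary_group n) \<and>
    (\<forall>x y. \<pi> (x + y) = \<pi> x * \<pi> y) \<and>
    (\<forall>i<n. \<forall>j<n. continuous_on UNIV (\<lambda>x. \<pi> x $$ (i, j)))"

definition MAP :: "'a::topological_group_add itself \<Rightarrow> bool"
  where "MAP _ \<longleftrightarrow> (\<forall>x y::'a. x \<noteq> y \<longrightarrow> (\<exists>n \<pi>. unitary_rep n \<pi> \<and> \<pi> x \<noteq> \<pi> y))"

definition d_independent :: "'a::topological_group_add itself \<Rightarrow> bool"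
  where "d_independent _ \<longleftrightarrow>
    (UNIV :: 'a set) \<noteq> {0} \<and>
    (\<forall>S::'a set. add_subgroup S \<and> S \<prec> (UNIV :: real set) \<longrightarrow>
      (\<exists>H. add_subgroup H \<and> countable H \<and> closure H = UNIV \<and> S \<inter> H = {0}))"

end

theory Submission
  imports Defs "Jordan_Normal_Form.Spectral_Radius"
begin

text \<open>
  Let \<open>G\<close> be the group, \<open>C\<close> the connected component of \<open>0\<close>, and \<open>S\<close> a subgroup with fewer than
  continuum many elements. It suffices to find a dense subgroup \<open>T\<close> that meets \<open>S\<close> only in \<open>0\<close>: being
  dense, \<open>T\<close> is separable, and a countable dense subset of \<open>T\<close> generates the countable subgroup
  wanted.
  
  Such a \<open>T\<close> is generated by points chosen by transfinite recursion. Since \<open>G\<close> itself is separable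
  and regular, continuum many nonempty open sets suffice to test density, namely the interiors of
  closures of subsets of a countable dense set (\<open>interior_closure_dense_sequence\<close>). Index them by a
  well-order whose proper initial segments have fewer than continuum many elements, and choose a
  point of each one that is independent of \<open>S\<close> and the points chosen before: if \<open>K\<close> is the subgroup
  generated by those, no positive multiple of the new point lies in \<open>K\<close>. Then the points generate a
  subgroup meeting \<open>S\<close> trivially (\<open>hull_transfinite_Int_trivial\<close>).
  
  What makes the choice possible is that the set \<open>Y\<close> of points having a positive multiple in \<open>K\<close>
  contains no nonempty open set (\<open>open_not_subset_isolator\<close>). As \<open>G\<close> is abelian, \<open>Y\<close> is a subgroup; if
  it contained a nonempty open set, it would be open and hence contain \<open>C\<close>. Take a unitary
  representation \<open>\<pi>\<close> that is not trivial on \<open>C\<close>, and let \<open>f\<close> be the real part of its trace. On a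
  unitary matrix of size \<open>n\<close> the real part of the trace is \<open>n\<close> only for the identity, so \<open>f\<close> is not constant on
  the connected set \<open>C\<close>, and \<open>f(C)\<close> contains an interval. On the other hand, for \<open>y \<in> Y\<close> the matrix
  \<open>\<pi>(y)\<close> is an \<open>m\<close>-th root of some \<open>\<pi>(k)\<close> with \<open>k \<in> K\<close>; the eigenvalues of such a root are \<open>m\<close>-th roots of
  eigenvalues of \<open>\<pi>(k)\<close>, so its trace takes only finitely many values for given \<open>m\<close> and \<open>k\<close>
  (\<open>finite_traces_of_mat_roots\<close>). Hence \<open>f(Y)\<close> has fewer than continuum many elements, and \<open>Y\<close> does
  not contain \<open>C\<close>. Using the trace avoids diagonalizing the commuting matrices \<open>\<pi>(x)\<close>
  simultaneously.
\<close>


section \<open>Sets of cardinality below the continuum\<close>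

abbreviation below_continuum :: "'a set \<Rightarrow> bool"
  where "below_continuum A \<equiv> A \<prec> (UNIV :: real set)"

lemma countable_below_continuum:
  assumes "countable A"
  shows "below_continuum A"
proof -
  have "A \<lesssim> (UNIV :: nat set)"
    using assms unfolding countable_def lepoll_def by blast
  also have "(UNIV :: nat set) \<prec> (UNIV :: real set)"
    using eq_lesspoll_trans lesspoll_Pow_self[of "UNIV :: nat set"]
      lesspoll_eq_trans[OF _ nat_sets_eqpoll_reals] by auto
  finally show ?thesis .
qed

lemma lepoll_iff_card_of_ordLeq:
  includes cardinal_syntax
  shows "A \<lesssim> B \<longleftrightarrow> |A| \<le>o |B|"
  unfolding lepoll_def by (rule card_of_ordLeq)

lemma lesspoll_iff_card_of_ordLess:
  includes cardinal_syntax
  shows "A \<prec> B \<longleftrightarrow> |A| <o |B|"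
proof -
  have "B \<lesssim> A \<or> A \<lesssim> B"
    unfolding lepoll_iff_card_of_ordLeq
    using ordLeq_total[OF card_of_Well_order card_of_Well_order] .
  then have "A \<prec> B \<longleftrightarrow> \<not> B \<lesssim> A"
    using lepoll_antisym eqpoll_imp_lepoll eqpoll_sym unfolding lesspoll_def by blast
  also have "\<dots> \<longleftrightarrow> |A| <o |B|"
    using card_of_ordLess[of B A] by (simp add: lepoll_def)
  finally show ?thesis .
qed

lemma UN_lepoll_infinite:
  assumes "infinite B" "I \<lesssim> B" "\<And>i. i \<in> I \<Longrightarrow> A i \<lesssim> B"
  shows "(\<Union>i\<in>I. A i) \<lesssim> B"
  using assms card_of_UNION_ordLeq_infinite[of B I A]
  unfolding lepoll_iff_card_of_ordLeq by blast

text \<open>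
  A union of countable sets over an uncountable index set \<open>I\<close> has at most the cardinality of \<open>I\<close>.
\<close>

lemma below_continuum_UN_countable:
  assumes "below_continuum I" "\<And>i. i \<in> I \<Longrightarrow> countable (A i)"
  shows "below_continuum (\<Union>i\<in>I. A i)"
proof (cases "countable I")
  case True
  then show ?thesis
    using assms(2) by (intro countable_below_continuum) auto
next
  case False
  then have inf: "infinite I"
    using countable_finite by blast
  then have "A i \<lesssim> I" if "i \<in> I" for i
    using assms(2)[OF that] infinite_le_lepoll lepoll_trans
    unfolding countable_def lepoll_def by (metis infinite_le_lepoll lepoll_def lepoll_trans subset_UNIV)
  then have "(\<Union>i\<in>I. A i) \<lesssim> I"
    using inf by (intro UN_lepoll_infinite) auto
  then show ?thesis
    using assms(1) lesspoll_trans1 by blast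
qed

text \<open>
  There are \<open>|A|\<close> lists of each length by induction, and only countably many lengths.
\<close>

lemma lists_lepoll_infinite:
  assumes "infinite A"
  shows "lists A \<lesssim> A"
proof -
  define L where "L n = {xs \<in> lists A. length xs = n}" for n
  have "L n \<lesssim> A" for n
  proof (induction n)
    case 0
    have "L 0 \<subseteq> {[]}"
      by (auto simp: L_def)
    then show ?case
      using assms by (meson finite.emptyI finite.insertI finite_lepoll_infinite finite_subset)
  next
    case (Suc n)
    have "L (Suc n) = (\<Union>x\<in>A. (#) x ` L n)"
      by (auto simp: L_def length_Suc_conv image_iff)
    also have "\<dots> \<lesssim> A"
      using assms Suc by (intro UN_lepoll_infinite) (auto intro: lepoll_trans[OF image_lepoll])
    finally show ?case .
  qed
  then have "(\<Union>n. L n) \<lesssim> A"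
    using assms infinite_le_lepoll by (intro UN_lepoll_infinite) auto
  also have "(\<Union>n. L n) = lists A"
    by (auto simp: L_def)
  finally show ?thesis .
qed

lemma below_continuum_lists:
  assumes "below_continuum A"
  shows "below_continuum (lists A)"
proof (cases "countable A")
  case True
  then show ?thesis
    by (simp add: countable_below_continuum)
next
  case False
  then show ?thesis
    using assms lists_lepoll_infinite lesspoll_trans1 countable_finite by blast
qed

lemma below_continuum_Un:
  assumes "below_continuum A" "below_continuum B"
  shows "below_continuum (A \<union> B)"
proof -
  have "infinite (UNIV :: real set)"
    using infinite_UNIV_char_0 by blast
  then show ?thesis
    using card_of_Un_ordLess_infinite assms by (auto simp: lesspoll_iff_card_of_ordLess)
qed

lemma below_continuum_image:
  assumes "below_continuum A"
  shows "below_continuum (f ` A)"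
  using image_lepoll assms by (rule lesspoll_trans1)

lemma interval_not_below_continuum:
  fixes A :: "real set"
  assumes "x < y" "{x..y} \<subseteq> A"
  shows "\<not> below_continuum A"
proof -
  have "A \<approx> (UNIV :: real set)"
    using assms by (intro eqpoll_real_subset[of x y]) auto
  then show ?thesis
    by (simp add: lesspoll_def)
qed

text \<open>
  The index set of the transfinite recursion is the power set of \<open>\<nat>\<close>, which has the cardinality of
  the continuum and whose members will name subsets of a dense sequence. The relation is the strict
  part of an initial well-order on it.
\<close>

lemma continuum_well_order:
  includes cardinal_syntax
  obtains R :: "(nat set \<times> nat set) set"
  where "wf R" "trans R" "total R" "\<And>i. below_continuum {j. (j, i) \<in> R}"
proof
  define r where "r = |UNIV :: nat set set|"
  have r: "Well_order r" "Card_order r" "Field r = UNIV"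
    unfolding r_def by (rule card_of_Well_order card_of_Card_order Field_card_of)+
  show "wf (r - Id)" 
    using r by (simp add: well_order_on_def)
  show "trans (r - Id)" "total (r - Id)"
    using r trans_diff_Id by (auto simp: order_on_defs total_on_diff_Id)
  fix i :: "nat set"
  have "{j. (j, i) \<in> r - Id} = underS r i"
    by (auto simp: underS_def)
  also have "|underS r i| <o r"
    unfolding r_def by (rule card_of_underS[OF card_of_Card_order]) (simp add: Field_card_of)
  finally have "{j. (j, i) \<in> r - Id} \<prec> (UNIV :: nat set set)"
    by (simp add: lesspoll_iff_card_of_ordLess r_def)
  then show "below_continuum {j. (j, i) \<in> r - Id}"
    using lesspoll_eq_trans nat_sets_eqpoll_reals by blast
qed

section \<open>Subgroups and independence in abelian groups\<close>

lemma add_subgroupI: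
  assumes "0 \<in> H" "\<And>x y. x \<in> H \<Longrightarrow> y \<in> H \<Longrightarrow> x + y \<in> H" "\<And>x. x \<in> H \<Longrightarrow> - x \<in> H"
  shows "add_subgroup H"
  using assms by (auto simp: add_subgroup_def)

lemma add_subgroup_0: "add_subgroup H \<Longrightarrow> 0 \<in> H"
  and add_subgroup_add: "add_subgroup H \<Longrightarrow> x \<in> H \<Longrightarrow> y \<in> H \<Longrightarrow> x + y \<in> H"
  and add_subgroup_minus: "add_subgroup H \<Longrightarrow> x \<in> H \<Longrightarrow> - x \<in> H"
  by (auto simp: add_subgroup_def)

lemma add_subgroup_diff: "add_subgroup H \<Longrightarrow> x \<in> H \<Longrightarrow> y \<in> H \<Longrightarrow> x - y \<in> H"
  by (metis add_subgroup_add add_subgroup_minus diff_conv_add_uminus)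

lemma add_subgroup_hull: "add_subgroup (add_subgroup hull A)"
  by (rule hull_in) (auto simp: add_subgroup_def)

text \<open>
  Writing the elements of a generated subgroup as sums of lists bounds their number.
\<close>

lemma hull_subset_sum_list:
  "add_subgroup hull A \<subseteq> sum_list ` lists (A \<union> uminus ` A)"
proof (rule hull_minimal)
  have neg: "- sum_list xs = sum_list (rev (map uminus xs))" for xs :: "'a::group_add list"
    by (induction xs) (auto simp: minus_add)
  show "A \<subseteq> sum_list ` lists (A \<union> uminus ` A)"
  proof
    fix a assume "a \<in> A"
    then show "a \<in> sum_list ` lists (A \<union> uminus ` A)"
      by (intro image_eqI[of _ _ "[a]"]) auto
  qed
  show "add_subgroup (sum_list ` lists (A \<union> uminus ` A))"
    proof (rule add_subgroupI)
    show "0 \<in> sum_list ` lists (A \<union> uminus ` A)"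
      by (intro image_eqI[of _ _ "[]"]) auto
  next
    fix x y assume "x \<in> sum_list ` lists (A \<union> uminus ` A)" "y \<in> sum_list ` lists (A \<union> uminus ` A)"
    then obtain xs ys where "xs \<in> lists (A \<union> uminus ` A)" "ys \<in> lists (A \<union> uminus ` A)"
      "x = sum_list xs" "y = sum_list ys"
      by blast
    then show "x + y \<in> sum_list ` lists (A \<union> uminus ` A)"
      by (intro image_eqI[of _ _ "xs @ ys"]) auto
  next
    fix x assume "x \<in> sum_list ` lists (A \<union> uminus ` A)"
    then obtain xs where "xs \<in> lists (A \<union> uminus ` A)" "x = sum_list xs"
      by blast
    then show "- x \<in> sum_list ` lists (A \<union> uminus ` A)"
      by (intro image_eqI[of _ _ "rev (map uminus xs)"]) (fastforce simp: neg in_lists_conv_set)+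
  qed
qed

lemma countable_hull:
  assumes "countable A"
  shows "countable (add_subgroup hull A)"
  using assms by (intro countable_subset[OF hull_subset_sum_list]) auto

lemma below_continuum_hull:
  assumes "below_continuum A"
  shows "below_continuum (add_subgroup hull A)"
proof -
  have "below_continuum (sum_list ` lists (A \<union> uminus ` A))"
    using assms by (intro below_continuum_image below_continuum_lists below_continuum_Un)
  then show ?thesis
    by (rule lesspoll_trans1[OF subset_imp_lepoll[OF hull_subset_sum_list]])
qed

primrec multiple :: "nat \<Rightarrow> 'a::monoid_add \<Rightarrow> 'a" where
  "multiple 0 x = 0"
| "multiple (Suc n) x = x + multiple n x"

lemma multiple_add_left: "multiple (m + n) x = multiple m x + multiple n x"
  by (induction m) (auto simp: add.assoc)

lemma multiple_add_right: "multiple n (x + y) = multiple n x + multiple n y"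
  for x y :: "'a::comm_monoid_add"
  by (induction n) (auto simp: algebra_simps)

lemma multiple_minus: "multiple n (- x) = - multiple n x"
  for x :: "'a::ab_group_add"
  by (induction n) auto

lemma multiple_mult: "multiple (m * n) x = multiple m (multiple n x)"
  by (induction m) (auto simp: multiple_add_left)

lemma multiple_zero: "multiple n 0 = 0"
  by (induction n) auto

lemma add_subgroup_multiple: "add_subgroup H \<Longrightarrow> x \<in> H \<Longrightarrow> multiple n x \<in> H"
  by (induction n) (auto simp: add_subgroup_0 add_subgroup_add)

text \<open>
  The usual name of this set when \<open>K\<close> is a subgroup of an abelian group; it is the preimage of the
  torsion subgroup of the quotient by \<open>K\<close>.
\<close>

definition isolator :: "'a::group_add set \<Rightarrow> 'a set"
  where "isolator K = {x. \<exists>n>0. multiple n x \<in> K}"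

text \<open>
  Commutativity is essential here: \<open>mn(x + y) = n(mx) + m(ny)\<close>.
\<close>

lemma add_subgroup_isolator:
  fixes K :: "'a::ab_group_add set"
  assumes K: "add_subgroup K"
  shows "add_subgroup (isolator K)"
proof (rule add_subgroupI)
  show "0 \<in> isolator K"
    using K by (auto simp: isolator_def multiple_zero add_subgroup_0)
next
  fix x y assume "x \<in> isolator K" "y \<in> isolator K"
  then obtain m n where mn: "m > 0" "n > 0" "multiple m x \<in> K" "multiple n y \<in> K"
    by (auto simp: isolator_def)
  have "multiple (n * m) (x + y) = multiple n (multiple m x) + multiple m (multiple n y)"
    by (metis mult.commute multiple_add_right multiple_mult)
  also have "\<dots> \<in> K"
    using K mn by (simp add: add_subgroup_add add_subgroup_multiple)
  finally show "x + y \<in> isolator K"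
    using mn(1,2) unfolding isolator_def by (blast intro: mult_pos_pos)
next
  fix x assume "x \<in> isolator K"
  then show "- x \<in> isolator K"
    using K by (auto simp: isolator_def multiple_minus intro: add_subgroup_minus)
qed

text \<open>
  Integer multiples of \<open>a\<close> are written as differences of natural multiples, which spares a
  distinction of signs in the closure under addition.
\<close>

lemma hull_insert_subset:
  fixes a :: "'a::ab_group_add"
  shows "add_subgroup hull (insert a A)
    \<subseteq> {multiple p a - multiple q a + z | p q z. z \<in> add_subgroup hull A}"
    (is "_ \<subseteq> ?M")
proof (rule hull_minimal)
  have sub: "add_subgroup (add_subgroup hull A)"
    by (rule add_subgroup_hull)
  have I: "x \<in> ?M" if "x = multiple p a - multiple q a + z" "z \<in> add_subgroup hull A" for x p q z
    using that by blast
  show "insert a A \<subseteq> ?M"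
  proof
    fix x assume "x \<in> insert a A"
    then consider "x = a" | "x \<in> A"
      by blast
    then show "x \<in> ?M"
    proof cases
      case 1
      then show ?thesis
        using sub by (intro I[of _ 1 0 0]) (auto simp: add_subgroup_0)
    next
      case 2
      then show ?thesis
        by (intro I[of _ 0 0 x]) (auto simp: hull_inc)
    qed
  qed
  show "add_subgroup ?M"
    proof (rule add_subgroupI)
    show "0 \<in> ?M"
      using sub by (intro I[of _ 0 0 0]) (auto simp: add_subgroup_0)
  next
    fix x y assume "x \<in> ?M" "y \<in> ?M"
    then obtain p q z p' q' z' where
      "x = multiple p a - multiple q a + z" "z \<in> add_subgroup hull A"
      "y = multiple p' a - multiple q' a + z'" "z' \<in> add_subgroup hull A"
      by blast
    then show "x + y \<in> ?M"
      using sub by (intro I[of _ "p + p'" "q + q'" "z + z'"])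
        (auto simp: multiple_add_left add_subgroup_add)
  next
    fix x assume "x \<in> ?M"
    then obtain p q z where "x = multiple p a - multiple q a + z" "z \<in> add_subgroup hull A"
      by blast
    then show "- x \<in> ?M"
      using sub by (intro I[of _ q p "- z"]) (auto simp: add_subgroup_minus)
  qed
qed

text \<open>
  An element of \<open>S\<close> in the enlarged subgroup has the form \<open>ka + z\<close> with an integer \<open>k\<close> and \<open>z\<close> generated
  by \<open>A\<close>. Then \<open>ka\<close> is generated by \<open>S \<union> A\<close>, which by independence of \<open>a\<close> forces \<open>k = 0\<close>.
\<close>

lemma hull_insert_Int_trivial:
  fixes a :: "'a::ab_group_add"
  assumes S: "add_subgroup S"
    and triv: "S \<inter> (add_subgroup hull A) = {0}"
    and a: "a \<notin> isolator (add_subgroup hull (S \<union> A))"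
  shows "S \<inter> (add_subgroup hull (insert a A)) = {0}"
proof -
  let ?K = "add_subgroup hull (S \<union> A)"
  have K: "add_subgroup ?K"
    by (rule add_subgroup_hull)
  have not_in: "multiple n a \<notin> ?K" if "n > 0" for n
    using a that unfolding isolator_def by blast
  have eq: "p = q" if "multiple p a - multiple q a \<in> ?K" for p q
  proof (rule ccontr)
    assume "p \<noteq> q"
    then consider "p > q" | "q > p" by linarith
    then show False
    proof cases
      case 1
      then have "multiple p a - multiple q a = multiple (p - q) a"
        using multiple_add_left[of "p - q" q a] by simp
      then show False using 1 that not_in[of "p - q"] by simp
    next
      case 2
      then have "- (multiple p a - multiple q a) = multiple (q - p) a"
        using multiple_add_left[of "q - p" p a] by simp
      then show False using 2 add_subgroup_minus[OF K that] not_in[of "q - p"] by simp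
    qed
  qed
  have "x = 0" if xS: "x \<in> S" and x: "x \<in> add_subgroup hull (insert a A)" for x
  proof -
    obtain p q z where x: "x = multiple p a - multiple q a + z" and z: "z \<in> add_subgroup hull A"
      using x hull_insert_subset by blast
    have "x \<in> ?K" "z \<in> ?K"
      using xS z hull_mono[of A "S \<union> A" add_subgroup] by (auto simp: hull_inc)
    then have "multiple p a - multiple q a \<in> ?K"
      using add_subgroup_diff[OF K, of x z] by (simp add: x)
    then have "x = z"
      using eq x by force
    then show "x = 0"
      using triv xS z by blast
  qed
  then show ?thesis
    using add_subgroup_0[OF S] add_subgroup_0[OF add_subgroup_hull[of "insert a A"]] by auto
qed

lemma add_subgroup_Union_chain:
  assumes "\<C> \<noteq> {}" "\<And>H. H \<in> \<C> \<Longrightarrow> add_subgroup H"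
    and "\<And>H K. H \<in> \<C> \<Longrightarrow> K \<in> \<C> \<Longrightarrow> H \<subseteq> K \<or> K \<subseteq> H"
  shows "add_subgroup (\<Union>\<C>)"
proof (rule add_subgroupI)
  fix x y assume "x \<in> \<Union>\<C>" "y \<in> \<Union>\<C>"
  then obtain H where "H \<in> \<C>" "x \<in> H" "y \<in> H"
    using assms(3) by blast
  then show "x + y \<in> \<Union>\<C>"
    using assms(2) add_subgroup_add by blast
next
  show "0 \<in> \<Union>\<C>"
    using assms(1,2) add_subgroup_0 by blast
next
  fix x assume "x \<in> \<Union>\<C>"
  then show "- x \<in> \<Union>\<C>"
    using assms(2) add_subgroup_minus by blast
qed

text \<open>
  The subgroups generated by the initial segments of the family form a chain. Along this chain,
  triviality of the intersection with \<open>S\<close> passes to successors by \<open>hull_insert_Int_trivial\<close>, and to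
  limits because the union of a chain of subgroups is a subgroup.
\<close>

lemma hull_transfinite_Int_trivial:
  fixes x :: "'i \<Rightarrow> 'a::ab_group_add"
  assumes R: "wf R" "trans R" "total R"
    and S: "add_subgroup S"
    and x: "\<And>i. x i \<notin> isolator (add_subgroup hull (S \<union> x ` {j. (j, i) \<in> R}))"
  shows "S \<inter> (add_subgroup hull range x) = {0}"
proof -
  define T where "T i = add_subgroup hull (x ` {j. j = i \<or> (j, i) \<in> R})" for i
  have sub: "add_subgroup (T i)" for i
    unfolding T_def by (rule add_subgroup_hull)
  have mono: "T j \<subseteq> T i" if "(j, i) \<in> R" for i j
    unfolding T_def using that R(2) by (intro hull_mono) (auto dest: transD)
  have chain: "T i \<subseteq> T j \<or> T j \<subseteq> T i" for i j
    using R(3) mono by (metis UNIV_I order_refl total_on_def)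
  have mem: "x j \<in> T j" for j
    unfolding T_def by (auto intro: hull_inc)
  have hull_subset_UN: "add_subgroup hull (x ` J) \<subseteq> (\<Union>j\<in>J. T j)" if "J \<noteq> {}" for J
  proof (rule hull_minimal)
    show "add_subgroup (\<Union>j\<in>J. T j)"
      using that sub chain by (intro add_subgroup_Union_chain) auto
  qed (use mem in auto)
  have triv: "S \<inter> T i = {0}" for i
    using R(1)
  proof (induction i)
    case (less i)
    let ?J = "{j. (j, i) \<in> R}"
    have "S \<inter> (add_subgroup hull (x ` ?J)) \<subseteq> {0}"
    proof (cases "?J = {}")
      case True
      have "add_subgroup hull {} = {0 :: 'a}"
        by (rule hull_unique) (auto simp: add_subgroup_def)
      with True show ?thesis
        by (simp only: image_empty) blast
    next
      case False
      then show ?thesis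
        using hull_subset_UN[of ?J] less by blast
    qed
    then have "S \<inter> (add_subgroup hull (x ` ?J)) = {0}"
      using S add_subgroup_0 add_subgroup_hull by blast
    then have "S \<inter> (add_subgroup hull (insert (x i) (x ` ?J))) = {0}"
      by (rule hull_insert_Int_trivial[OF S _ x])
    moreover have "insert (x i) (x ` ?J) = x ` {j. j = i \<or> (j, i) \<in> R}"
      by auto
    ultimately show ?case
      by (simp only: T_def)
  qed
  have "S \<inter> (add_subgroup hull range x) \<subseteq> {0}"
    using hull_subset_UN[of UNIV] triv by blast
  then show ?thesis
    using S add_subgroup_0 add_subgroup_hull by blast
qed

section \<open>Traces of roots of matrices and of unitary matrices\<close>

definition mat_trace :: "'a::comm_monoid_add mat \<Rightarrow> 'a"
  where "mat_trace A = (\<Sum>i<dim_row A. A $$ (i, i))"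

lemma mat_trace_mult_commute:
  fixes A B :: "'a::comm_semiring_0 mat"
  assumes "A \<in> carrier_mat n m" "B \<in> carrier_mat m n"
  shows "mat_trace (A * B) = mat_trace (B * A)"
proof -
  have "mat_trace (A * B) = (\<Sum>i<n. \<Sum>j<m. A $$ (i, j) * B $$ (j, i))"
    using assms by (auto simp: mat_trace_def scalar_prod_def lessThan_atLeast0 intro!: sum.cong)
  also have "\<dots> = (\<Sum>j<m. \<Sum>i<n. B $$ (j, i) * A $$ (i, j))"
    by (subst sum.swap) (simp add: mult.commute)
  also have "\<dots> = mat_trace (B * A)"
    using assms by (auto simp: mat_trace_def scalar_prod_def lessThan_atLeast0 intro!: sum.cong)
  finally show ?thesis .
qed

lemma mat_trace_similar:
  fixes A B :: "'a::comm_ring_1 mat"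
  assumes "similar_mat_wit A B P Q"
  shows "mat_trace A = mat_trace B"
proof -
  define n where "n = dim_row A"
  note w = similar_mat_witD[OF n_def assms]
  have "mat_trace A = mat_trace (Q * (P * B))"
    unfolding w(3) using w by (intro mat_trace_mult_commute) auto
  also have "Q * (P * B) = (Q * P) * B"
    using w(5-7) by (metis assoc_mult_mat)
  also have "\<dots> = B"
    unfolding w(2) using w(5) by simp
  finally show ?thesis .
qed

text \<open>
  A Schur decomposition makes \<open>A\<close> similar to an upper triangular matrix with the eigenvalues on its
  diagonal.
\<close>

lemma mat_trace_eq_sum_eigenvalues:
  fixes A :: "complex mat"
  assumes A: "A \<in> carrier_mat n n"
  obtains es where "mat_trace A = sum_list es" "length es = n" "set es \<subseteq> spectrum A"
proof -
  obtain es where es: "char_poly A = (\<Prod>e\<leftarrow>es. [:- e, 1:])" "length es = n"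
    using char_poly_factorized[OF A] by blast
  obtain B P Q where "schur_decomposition A es = (B, P, Q)"
    by (cases "schur_decomposition A es")
  then have B: "similar_mat_wit A B P Q" "diag_mat B = es"
    using schur_decomposition[OF A es(1)] by auto
  have "mat_trace A = sum_list (diag_mat B)"
    unfolding mat_trace_similar[OF B(1)]
    by (simp add: mat_trace_def diag_mat_def interv_sum_list_conv_sum_set_nat lessThan_atLeast0)
  moreover have "set es \<subseteq> spectrum A"
    unfolding spectrum_root_char_poly[OF A] es(1) by (auto simp: poly_prod_list prod_list_zero_iff)
  ultimately show ?thesis
    using that B(2) es(2) by auto
qed

lemma eigenvalue_pow:
  fixes A :: "'a::comm_ring_1 mat"
  assumes A: "A \<in> carrier_mat n n" and e: "e \<in> spectrum A"
  shows "e ^ k \<in> spectrum (A ^\<^sub>m k)"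
proof -
  obtain v where v: "eigenvector A v e"
    using e unfolding spectrum_def eigenvalue_def by blast
  have "A ^\<^sub>m k \<in> carrier_mat n n"
    using A by simp
  then have "eigenvector (A ^\<^sub>m k) v (e ^ k)"
    using v A eigenvector_pow[OF A v, of k] unfolding eigenvector_def by simp
  then show ?thesis
    unfolding spectrum_def eigenvalue_def by blast
qed

text \<open>
  A matrix may have infinitely many \<open>k\<close>-th roots, but their eigenvalues are \<open>k\<close>-th roots of
  eigenvalues of \<open>B\<close>, so only finitely many lists of eigenvalues of length \<open>n\<close> can occur.
\<close>

lemma finite_traces_of_mat_roots:
  fixes B :: "complex mat"
  assumes B: "B \<in> carrier_mat n n" and k: "k > 0"
  shows "finite {mat_trace A | A. A \<in> carrier_mat n n \<and> A ^\<^sub>m k = B}"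
proof -
  let ?E = "\<Union>e\<in>spectrum B. {z. z ^ k = e}"
  have "finite ?E"
    using card_finite_spectrum(1)[OF B] finite_nth_roots[OF k] by auto
  then have "finite {es. set es \<subseteq> ?E \<and> length es = n}"
    by (rule finite_lists_length_eq)
  moreover have "{mat_trace A | A. A \<in> carrier_mat n n \<and> A ^\<^sub>m k = B}
      \<subseteq> sum_list ` {es. set es \<subseteq> ?E \<and> length es = n}"
  proof
    fix t assume "t \<in> {mat_trace A | A. A \<in> carrier_mat n n \<and> A ^\<^sub>m k = B}"
    then obtain A where A: "A \<in> carrier_mat n n" "A ^\<^sub>m k = B" and t: "t = mat_trace A"
      by blast
    obtain es where es: "mat_trace A = sum_list es" "length es = n" "set es \<subseteq> spectrum A"
      using mat_trace_eq_sum_eigenvalues[OF A(1)] .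
    then have "set es \<subseteq> ?E"
      using eigenvalue_pow[OF A(1), of _ k] unfolding A(2) by blast
    with es t show "t \<in> sum_list ` {es. set es \<subseteq> ?E \<and> length es = n}"
      by blast
  qed
  ultimately show ?thesis
    by (meson finite_imageI finite_subset)
qed

lemma unitary_row_norm:
  assumes U: "U \<in> unitary_group n" and i: "i < n"
  shows "(\<Sum>j<n. (cmod (U $$ (i, j)))\<^sup>2) = 1"
proof -
  have c: "U \<in> carrier_mat n n" and uu: "U * mat_adjoint U = 1\<^sub>m n"
    using U by (auto simp: unitary_group_def)
  have "1 = (U * mat_adjoint U) $$ (i, i)"
    using uu i by simp
  also have "\<dots> = (\<Sum>j<n. U $$ (i, j) * cnj (U $$ (i, j)))"
    using c i by (auto simp: mat_adjoint_def scalar_prod_def lessThan_atLeast0 mat_of_rows_def intro!: sum.cong)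
  also have "\<dots> = of_real (\<Sum>j<n. (cmod (U $$ (i, j)))\<^sup>2)"
    by (simp add: complex_norm_square del: of_real_power)
  finally show ?thesis
    by (metis of_real_1 of_real_eq_iff)
qed

text \<open>
  Each row of \<open>U\<close> is a unit vector. The diagonal entries therefore have real part at most \<open>1\<close>; if
  their sum is \<open>n\<close>, all of them equal \<open>1\<close>, and nothing remains for the other entries.
\<close>

lemma unitary_Re_trace_eq_dim_imp_one:
  assumes U: "U \<in> unitary_group n" and tr: "Re (mat_trace U) = real n"
  shows "U = 1\<^sub>m n"
proof (rule eq_matI)
  have c: "U \<in> carrier_mat n n"
    using U by (auto simp: unitary_group_def)
  then show "dim_row U = dim_row (1\<^sub>m n)" "dim_col U = dim_col (1\<^sub>m n)"
    by auto
  fix i j assume "i < dim_row (1\<^sub>m n)" "j < dim_col (1\<^sub>m n)"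
  then have ij: "i < n" "j < n" by auto
  have le: "(cmod (U $$ (i, j)))\<^sup>2 \<le> 1" if "i < n" "j < n" for i j
    unfolding unitary_row_norm[OF U that(1), symmetric] using that by (intro member_le_sum) auto
  have le1: "Re (U $$ (i, i)) \<le> 1" if "i < n" for i
    using le[OF that that] complex_Re_le_cmod[of "U $$ (i, i)"] by (simp add: abs_square_le_1)
  have "(\<Sum>i<n. 1 - Re (U $$ (i, i))) = 0"
    using tr c by (simp add: mat_trace_def sum_subtractf)
  then have "1 - Re (U $$ (i, i)) = 0"
    using le1 ij by (subst (asm) sum_nonneg_eq_0_iff) auto
  then have Re1: "Re (U $$ (i, i)) = 1" by simp
  have norm: "(Re (U $$ (i, i)))\<^sup>2 + (Im (U $$ (i, i)))\<^sup>2 + (\<Sum>j\<in>{..<n} - {i}. (cmod (U $$ (i, j)))\<^sup>2) = 1"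
    using unitary_row_norm[OF U ij(1)] ij by (simp add: sum.remove[of _ i] cmod_power2)
  have nn: "(\<Sum>j\<in>{..<n} - {i}. (cmod (U $$ (i, j)))\<^sup>2) \<ge> 0"
    by (intro sum_nonneg) auto
  have "(Im (U $$ (i, i)))\<^sup>2 = 0" and z: "(\<Sum>j\<in>{..<n} - {i}. (cmod (U $$ (i, j)))\<^sup>2) = 0"
    using norm[unfolded Re1 one_power2] nn zero_le_power2[of "Im (U $$ (i, i))"] by linarith+
  then have "U $$ (i, i) = 1"
    using Re1 by (simp add: complex_eq_iff)
  moreover have "U $$ (i, j) = 0" if "j \<noteq> i"
    using z ij that by (subst (asm) sum_nonneg_eq_0_iff) auto
  ultimately show "U $$ (i, j) = 1\<^sub>m n $$ (i, j)"
    using ij by auto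
qed

section \<open>Topological groups\<close>

text \<open>
  A subgroup containing a nonempty open set is open, and so is its complement, a union of cosets.
  It therefore contains every connected set through \<open>0\<close>.
\<close>

lemma connected_component_subset_subgroup:
  fixes Y U :: "'a::topological_group_add set"
  assumes Y: "add_subgroup Y" and U: "open U" "U \<noteq> {}" "U \<subseteq> Y"
  shows "connected_component_set UNIV 0 \<subseteq> Y"
proof -
  obtain u where u: "u \<in> U"
    using U(2) by blast
  \<comment> \<open>The translate \<open>U - u + y\<close> is a neighbourhood of \<open>y\<close> inside the coset \<open>Y + y\<close>.\<close>
  have open_coset: "open ((\<lambda>x. x - y + u) -` U)" for y
    using U(1) by (rule open_vimage) (intro continuous_intros)
  have coset_subset: "(\<lambda>x. x - y + u) -` U \<subseteq> (\<lambda>x. x - y) -` Y" for y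
  proof (intro subsetI vimageI2)
    fix x assume "x \<in> (\<lambda>x. x - y + u) -` U"
    then have "x - y + u - u \<in> Y"
      using U(3) u by (intro add_subgroup_diff[OF Y]) auto
    then show "x - y \<in> Y" by simp
  qed
  have Y_add: "x \<in> Y" if "y \<in> Y" "x - y \<in> Y" for x y
    using add_subgroup_add[OF Y that(2,1)] by simp
  have Y_diff: "y \<in> Y" if "x \<in> Y" "x - y \<in> Y" for x y
    using add_subgroup_add[OF Y add_subgroup_minus[OF Y that(2)] that(1)] by simp
  have "open Y"
  proof (rule topological_space_class.openI)
    fix y assume "y \<in> Y"
    then have "(\<lambda>x. x - y + u) -` U \<subseteq> Y"
      using coset_subset[of y] Y_add by blast
    then show "\<exists>T. open T \<and> y \<in> T \<and> T \<subseteq> Y"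
      using open_coset[of y] u by (intro exI conjI) auto
  qed
  moreover have "open (- Y)"
  proof (rule topological_space_class.openI)
    fix y assume "y \<in> - Y"
    then have "(\<lambda>x. x - y + u) -` U \<subseteq> - Y"
      using coset_subset[of y] Y_diff by blast
    then show "\<exists>T. open T \<and> y \<in> T \<and> T \<subseteq> - Y"
      using open_coset[of y] u by (intro exI conjI) auto
  qed
  moreover have "connected (connected_component_set UNIV (0::'a))"
    by simp
  moreover have "0 \<in> connected_component_set UNIV (0::'a) \<inter> Y"
    using Y by (simp add: add_subgroup_0)
  ultimately show ?thesis
    using connectedD[of "connected_component_set UNIV (0::'a)" Y "- Y"] by blast
qed

text \<open>
  Continuity of addition at \<open>(u, 0)\<close> gives neighbourhoods \<open>A\<close> of \<open>u\<close> and \<open>B\<close> of \<open>0\<close> with \<open>A + B\<close> inside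
  \<open>U\<close>, and every point of the closure of \<open>A\<close> lies in \<open>A + B\<close>.
\<close>

lemma nhds_regular:
  fixes U :: "'a::topological_group_add set"
  assumes U: "open U" "u \<in> U"
  obtains V where "open V" "u \<in> V" "closure V \<subseteq> U"
proof -
  have "open ((\<lambda>(x, y). x + y) -` U)"
    unfolding case_prod_unfold using U(1) by (rule open_vimage) (intro continuous_intros)
  then obtain A B where AB: "open A" "open B" "u \<in> A" "0 \<in> B" "A \<times> B \<subseteq> (\<lambda>(x, y). x + y) -` U"
    using U(2) by (elim open_prod_elim[of _ "(u, 0)"]) auto
  have "closure A \<subseteq> U"
  proof
    fix x assume x: "x \<in> closure A"
    have "open ((\<lambda>a. - a + x) -` B)"
      using AB(2) by (rule open_vimage) (intro continuous_intros)
    moreover have "x \<in> (\<lambda>a. - a + x) -` B"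
      using AB(4) by simp
    ultimately have "A \<inter> (\<lambda>a. - a + x) -` B \<noteq> {}"
      using x unfolding closure_iff_nhds_not_empty by blast
    then obtain a where "a \<in> A" "- a + x \<in> B"
      by blast
    then have "a + (- a + x) \<in> U"
      using AB(5) by auto
    then show "x \<in> U"
      by (simp add: add.assoc[symmetric])
  qed
  then show ?thesis
    using that AB by blast
qed

text \<open>
  This bounds the number of open sets needed to test density by the continuum: if \<open>V\<close> is open with
  closure in \<open>U\<close>, the terms of the sequence lying in \<open>V\<close> are dense in \<open>V\<close>.
\<close>

lemma interior_closure_dense_sequence:
  fixes e :: "nat \<Rightarrow> 'a::topological_group_add"
  assumes dense: "closure (range e) = UNIV" and U: "open U" "U \<noteq> {}"
  obtains i where "interior (closure (e ` i)) \<noteq> {}" "interior (closure (e ` i)) \<subseteq> U"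
proof -
  obtain u where "u \<in> U"
    using U(2) by blast
  then obtain V where V: "open V" "u \<in> V" "closure V \<subseteq> U"
    using nhds_regular U(1) by metis
  have "V \<subseteq> closure (e ` (e -` V))"
    using open_Int_closure_subset[OF V(1), of "range e"] dense
    by (metis Int_commute image_vimage_eq inf_top.right_neutral)
  then have "V \<subseteq> interior (closure (e ` (e -` V)))"
    using V(1) by (rule interior_maximal)
  moreover have "interior (closure (e ` (e -` V))) \<subseteq> U"
    using V(3) closure_mono[of "e ` (e -` V)" V] interior_subset by blast
  ultimately show ?thesis
    using that V(2) by blast
qed

lemma separable_dense_subset:
  assumes "separable_space (top_of_set T)" "closure T = UNIV"
  obtains D where "countable D" "D \<subseteq> T" "closure D = UNIV"
proof -
  obtain D where D: "countable D" "D \<subseteq> T" "(top_of_set T) closure_of D = T"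
    using assms(1) by (auto simp: separable_space_def)
  have "T \<subseteq> closure D"
    using D(3) closure_of_subtopology_subset[of euclidean T D] by simp
  then have "closure T \<subseteq> closure D"
    by (simp add: closure_minimal)
  then show ?thesis
    using that D assms(2) by auto
qed

section \<open>Points independent of a small subgroup\<close>

lemma unitary_rep_zero:
  assumes "unitary_rep n \<pi>"
  shows "\<pi> 0 = 1\<^sub>m n"
proof -
  let ?U = "\<pi> 0"
  have U: "?U \<in> carrier_mat n n" "?U * mat_adjoint ?U = 1\<^sub>m n" and idem: "?U * ?U = ?U"
    using assms unfolding unitary_rep_def unitary_group_def
    by (blast, blast, metis add.right_neutral)
  have adj: "mat_adjoint ?U \<in> carrier_mat n n"
    using U(1) by (auto simp: mat_adjoint_def)
  have "?U = ?U * (?U * mat_adjoint ?U)"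
    using U by simp
  also have "\<dots> = ?U * ?U * mat_adjoint ?U"
    using U(1) adj by simp
  also have "\<dots> = 1\<^sub>m n"
    unfolding idem using U(2) .
  finally show ?thesis .
qed

lemma unitary_rep_multiple:
  fixes x :: "'a::topological_ab_group_add"
  assumes "unitary_rep n \<pi>"
  shows "\<pi> (multiple k x) = \<pi> x ^\<^sub>m k"
proof (induction k)
  case 0
  have "dim_row (\<pi> x) = n"
    using assms by (auto simp: unitary_rep_def unitary_group_def)
  then show ?case
    using unitary_rep_zero[OF assms] by simp
next
  case (Suc k)
  have "\<pi> (multiple (Suc k) x) = \<pi> (multiple k x + x)"
    by (simp add: add.commute)
  also have "\<dots> = \<pi> (multiple k x) * \<pi> x"
    using assms unfolding unitary_rep_def by blast
  finally have "\<pi> (multiple (Suc k) x) = \<pi> (multiple k x) * \<pi> x" .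
  with Suc show ?case by simp
qed

lemma below_continuum_traces_isolator:
  fixes K :: "'a::topological_ab_group_add set"
  assumes \<pi>: "unitary_rep n \<pi>" and K: "below_continuum K"
  shows "below_continuum ((\<lambda>x. Re (mat_trace (\<pi> x))) ` isolator K)"
proof -
  have carrier: "\<pi> x \<in> carrier_mat n n" for x
    using \<pi> by (auto simp: unitary_rep_def unitary_group_def)
  define T where "T k m = {mat_trace A | A. A \<in> carrier_mat n n \<and> A ^\<^sub>m m = \<pi> k}" for k m
  have "(\<lambda>x. Re (mat_trace (\<pi> x))) ` isolator K \<subseteq> (\<Union>k\<in>K. \<Union>m\<in>{0<..}. Re ` T k m)"
  proof (rule image_subsetI)
    fix x assume "x \<in> isolator K"
    then obtain m where m: "m > 0" "multiple m x \<in> K"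
      by (auto simp: isolator_def)
    then have "mat_trace (\<pi> x) \<in> T (multiple m x) m"
      unfolding T_def using carrier unitary_rep_multiple[OF \<pi>, of m x] by force
    with m show "Re (mat_trace (\<pi> x)) \<in> (\<Union>k\<in>K. \<Union>m\<in>{0<..}. Re ` T k m)"
      by blast
  qed
  moreover have "countable (Re ` T k m)" if "m > 0" for k m
    using finite_traces_of_mat_roots[OF carrier that] unfolding T_def
    by (intro countable_image countable_finite)
  then have "countable (\<Union>m\<in>{0<..}. Re ` T k m)" for k
    by (intro countable_UN) auto
  then have "below_continuum (\<Union>k\<in>K. \<Union>m\<in>{0<..}. Re ` T k m)"
    using K by (intro below_continuum_UN_countable)
  ultimately show ?thesis
    using subset_imp_lepoll lesspoll_trans1 by blast
qed

text \<open>
  The image of \<open>C\<close> in the reals is connected and contains two different values, the value \<open>n\<close> at \<open>0\<close> and a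
  different one at \<open>c\<close>.
\<close>

lemma connected_traces_not_below_continuum:
  assumes \<pi>: "unitary_rep n \<pi>" and C: "connected C" "0 \<in> C" "c \<in> C" and c: "\<pi> c \<noteq> \<pi> 0"
  shows "\<not> below_continuum ((\<lambda>x. Re (mat_trace (\<pi> x))) ` C)"
proof -
  let ?f = "\<lambda>x. Re (mat_trace (\<pi> x))"
  have U: "\<pi> x \<in> unitary_group n" for x
    using \<pi> by (auto simp: unitary_rep_def)
  then have "dim_row (\<pi> x) = n" for x
    by (auto simp: unitary_group_def)
  then have f: "?f = (\<lambda>x. \<Sum>i<n. Re (\<pi> x $$ (i, i)))"
    by (simp add: mat_trace_def)
  have "continuous_on UNIV ?f"
    unfolding f using \<pi> by (intro continuous_intros) (auto simp: unitary_rep_def)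
  then have conn: "connected (?f ` C)"
    using C(1) by (intro connected_continuous_image) (auto intro: continuous_on_subset)
  have "?f 0 = n"
    by (simp add: unitary_rep_zero[OF \<pi>] mat_trace_def)
  moreover have "?f c \<noteq> n"
    using unitary_Re_trace_eq_dim_imp_one[OF U] c unitary_rep_zero[OF \<pi>] by metis
  ultimately consider "?f 0 < ?f c" | "?f c < ?f 0"
    by linarith
  then show ?thesis
  proof cases
    case 1
    then show ?thesis
      using connected_contains_Icc[OF conn, of "?f 0" "?f c"] C
      by (intro interval_not_below_continuum[of "?f 0" "?f c"]) auto
  next
    case 2
    then show ?thesis
      using connected_contains_Icc[OF conn, of "?f c" "?f 0"] C
      by (intro interval_not_below_continuum[of "?f c" "?f 0"]) auto
  qed
qed

text \<open>
  An isolator containing a nonempty open set would contain the component of \<open>0\<close>, on which a suitable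
  trace takes continuum many values.
\<close>

lemma open_not_subset_isolator:
  fixes K U :: "'a::topological_ab_group_add set"
  assumes MAP: "MAP TYPE('a)" and C: "connected_component_set UNIV (0::'a) \<noteq> {0}"
    and K: "add_subgroup K" "below_continuum K" and U: "open U" "U \<noteq> {}"
  shows "\<not> U \<subseteq> isolator K"
proof
  let ?C = "connected_component_set UNIV (0::'a)"
  assume "U \<subseteq> isolator K"
  then have sub: "?C \<subseteq> isolator K"
    using connected_component_subset_subgroup add_subgroup_isolator K(1) U by blast
  have "0 \<in> ?C"
    by simp
  with C obtain c where c: "c \<in> ?C" "c \<noteq> 0"
    by blast
  then obtain n \<pi> where \<pi>: "unitary_rep n \<pi>" "\<pi> c \<noteq> \<pi> 0"
    using MAP unfolding MAP_def by blast
  have "\<not> below_continuum ((\<lambda>x. Re (mat_trace (\<pi> x))) ` ?C)"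
    using connected_traces_not_below_continuum[OF \<pi>(1) _ _ c(1) \<pi>(2)] by simp
  moreover have "below_continuum ((\<lambda>x. Re (mat_trace (\<pi> x))) ` ?C)"
    using below_continuum_traces_isolator[OF \<pi>(1) K(2)] sub
    by (meson image_mono lesspoll_trans1 subset_imp_lepoll)
  ultimately show False by blast
qed

section \<open>Transfinite construction of the dense subgroup\<close>

lemma exists_transfinite_selection:
  fixes Z :: "'i \<Rightarrow> 'a set" and bad :: "'a set \<Rightarrow> 'a set"
  assumes "wf R" "\<And>i A. \<exists>x\<in>Z i. x \<notin> bad (A ` {j. (j, i) \<in> R})"
  obtains x where "\<And>i. x i \<in> Z i" "\<And>i. x i \<notin> bad (x ` {j. (j, i) \<in> R})"
proof -
  have "\<exists>x. \<forall>i. x i \<in> Z i \<and> x i \<notin> bad (x ` {j. (j, i) \<in> R})"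
  proof (rule dependent_wf_choice[OF assms(1)])
    fix f g :: "'i \<Rightarrow> 'a" and i r
    assume "\<And>z. (z, i) \<in> R \<Longrightarrow> f z = g z"
    then have "f ` {j. (j, i) \<in> R} = g ` {j. (j, i) \<in> R}"
      by (auto intro: image_cong)
    then show "(r \<in> Z i \<and> r \<notin> bad (f ` {j. (j, i) \<in> R})) = (r \<in> Z i \<and> r \<notin> bad (g ` {j. (j, i) \<in> R}))"
      by simp
  qed (use assms(2) in blast)
  then show ?thesis
    using that by blast
qed

text \<open>
  At stage \<open>i\<close> the subgroup generated by \<open>S\<close> and the earlier points is below the continuum, so its
  isolator leaves a point of the open set assigned to \<open>i\<close>.
\<close>

lemma exists_dense_subgroup_Int_trivial:
  fixes S :: "'a::topological_ab_group_add set"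
  assumes MAP: "MAP TYPE('a)" and C: "connected_component_set UNIV (0::'a) \<noteq> {0}"
    and D: "countable D" "closure D = (UNIV :: 'a set)"
    and S: "add_subgroup S" "below_continuum S"
  obtains T where "add_subgroup T" "closure T = UNIV" "S \<inter> T = {0}"
proof -
  obtain R :: "(nat set \<times> nat set) set"
    where R: "wf R" "trans R" "total R" "\<And>i. below_continuum {j. (j, i) \<in> R}"
    using continuum_well_order by blast
  have "D \<noteq> {}"
    using D(2) by auto
  then have e: "closure (range (from_nat_into D)) = UNIV"
    using D by (simp add: range_from_nat_into)
  define W where "W i = interior (closure (from_nat_into D ` i))" for i
  \<comment> \<open>A set of terms whose closure has empty interior imposes no condition on the chosen point.\<close>
  define Z where "Z i = (if W i = {} then UNIV else W i)" for i
  have Z: "open (Z i)" "Z i \<noteq> {}" for i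
    by (auto simp: Z_def W_def)
  have "below_continuum (add_subgroup hull (S \<union> x ` {j. (j, i) \<in> R}))" for x :: "nat set \<Rightarrow> 'a" and i
    using S(2) R(4) by (intro below_continuum_hull below_continuum_Un below_continuum_image)
  then have "\<exists>y\<in>Z i. y \<notin> isolator (add_subgroup hull (S \<union> x ` {j. (j, i) \<in> R}))" for x :: "nat set \<Rightarrow> 'a" and i
    using open_not_subset_isolator[OF MAP C add_subgroup_hull _ Z] by blast
  then obtain x where x: "\<And>i. x i \<in> Z i"
    "\<And>i. x i \<notin> isolator (add_subgroup hull (S \<union> x ` {j. (j, i) \<in> R}))"
    using exists_transfinite_selection[OF R(1), of Z "\<lambda>B. isolator (add_subgroup hull (S \<union> B))"]
    by blast
  have "closure (add_subgroup hull range x) = UNIV"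
  proof -
    have "U \<inter> (add_subgroup hull range x) \<noteq> {}" if U: "open U" "U \<noteq> {}" for U
    proof -
      obtain i where i: "W i \<noteq> {}" "W i \<subseteq> U"
        using interior_closure_dense_sequence[OF e U] unfolding W_def by blast
      then have "x i \<in> U"
        using x(1)[of i] by (auto simp: Z_def)
      then show ?thesis
        by (auto intro: hull_inc)
    qed
    from this[of "- closure (add_subgroup hull range x)"] show ?thesis
      using closure_subset[of "add_subgroup hull range x"] by blast
  qed
  moreover have "S \<inter> (add_subgroup hull range x) = {0}"
    by (rule hull_transfinite_Int_trivial[OF R(1-3) S(1), of x]) (rule x(2))
  ultimately show ?thesis
    by (rule that[OF add_subgroup_hull])
qed

text \<open>
  Separability of dense subgroups is used twice: for \<open>G\<close> itself, to run the construction, and for the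
  dense subgroup constructed, to cut it down to a countable one.
\<close>

theorem theorem4p31:
  assumes "dense_subgroup_separable TYPE('a::{topological_ab_group_add, t2_space})"
    and "MAP TYPE('a)"
    and "connected_component_set UNIV (0::'a) \<noteq> {0}"
  shows "d_independent TYPE('a)"
  unfolding d_independent_def
proof (intro conjI allI impI)
  have sep: "separable_space (top_of_set H)" if "add_subgroup H" "closure H = UNIV" for H :: "'a set"
    using assms(1) that by (simp add: dense_subgroup_separable_def)
  show "(UNIV :: 'a set) \<noteq> {0}"
    using assms(3) by (metis UNIV_I connected_component_refl mem_Collect_eq subset_UNIV subset_singletonD empty_iff)
  fix S :: "'a set"
  assume S: "add_subgroup S \<and> below_continuum S"
  have "add_subgroup (UNIV :: 'a set)"
    by (auto simp: add_subgroup_def)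
  then obtain D :: "'a set" where "countable D" "closure D = UNIV"
    using separable_dense_subset[of UNIV] sep closure_UNIV by metis
  then obtain T where T: "add_subgroup T" "closure T = UNIV" "S \<inter> T = {0}"
    using exists_dense_subgroup_Int_trivial[OF assms(2,3)] S by metis
  then obtain E where E: "countable E" "E \<subseteq> T" "closure E = UNIV"
    using separable_dense_subset sep by metis
  let ?H = "add_subgroup hull E"
  have "closure ?H = UNIV"
    using E(3) closure_mono[of E ?H] hull_subset[of E add_subgroup] by auto
  moreover have "?H \<subseteq> T"
    using E(2) T(1) by (rule hull_minimal)
  then have "S \<inter> ?H = {0}"
    using T(3) S add_subgroup_0 add_subgroup_hull by blast
  ultimately show "\<exists>H. add_subgroup H \<and> countable H \<and> closure H = UNIV \<and> S \<inter> H = {0}"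
    using add_subgroup_hull countable_hull[OF E(1)] by blast
qed

end
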